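(* Let $G$ be a compact Lie group and $N\subseteq G$ a normal closed subgroup of finite index. Then the inclusion $N\subseteq G$ is orthogonally final.
   Context: The inclusion $i\colon N\subseteq G$ of a normal (closed) subgroup of a compact Lie group is called orthogonally final if for every orthogonal $N$-representation $W$ there is an orthogonal $G$-representation $V$ and an $N$-linear isometric embedding $W\to i^*V$ inducing an isomorphism $W^N\cong(i^*V)^N$ on $N$-fixed spaces. Orthogonal representations are finite dimensional real inner product spaces with continuous action by linear isometries. *)

theory Defs
  imports "HOL-Analysis.Analysis" "HOL-Algebra.Group_Action"
begin

section \<open>Smooth manifolds and Lie groups\<close>

text \<open>
  Charts take values in \<^term>\<open>Euclidean_space n\<close>, the space of sequences vanishing from index
  \<open>n\<close> on, instead of a type of class \<open>euclidean_space\<close>: such a type has positive dimension, and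
  zero-dimensional (i.e. finite) compact Lie groups have to be covered.
\<close>

text \<open>
  \<open>C_k_on k n S f\<close>: the function \<open>f\<close> on the open subset \<open>S\<close> of \<open>\<real>\<^sup>n\<close> is continuous and its
  iterated partial derivatives up to order \<open>k\<close> exist and are continuous on \<open>S\<close>.
\<close>

primrec C_k_on :: "nat \<Rightarrow> nat \<Rightarrow> (nat \<Rightarrow> real) set \<Rightarrow> ((nat \<Rightarrow> real) \<Rightarrow> real) \<Rightarrow> bool" where
  "C_k_on 0 n S f \<longleftrightarrow>
     continuous_map (subtopology (Euclidean_space n) S) euclideanreal f"
| "C_k_on (Suc k) n S f \<longleftrightarrow>
     continuous_map (subtopology (Euclidean_space n) S) euclideanreal f \<and>
     (\<forall>i<n. \<exists>f'. C_k_on k n S f' \<and>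
        (\<forall>x\<in>S. ((\<lambda>t. f (x(i := t))) has_real_derivative f' x) (at (x i))))"

definition C_infinity_on ::
    "nat \<Rightarrow> nat \<Rightarrow> (nat \<Rightarrow> real) set \<Rightarrow> ((nat \<Rightarrow> real) \<Rightarrow> nat \<Rightarrow> real) \<Rightarrow> bool" where
  "C_infinity_on m n S f \<longleftrightarrow> openin (Euclidean_space m) S \<and>
     f \<in> S \<rightarrow> topspace (Euclidean_space n) \<and> (\<forall>k. \<forall>j<n. C_k_on k m S (\<lambda>x. f x j))"

type_synonym 'a chart = "'a set \<times> ('a \<Rightarrow> nat \<Rightarrow> real)"

definition chart_on :: "'a topology \<Rightarrow> nat \<Rightarrow> 'a chart \<Rightarrow> bool" where
  "chart_on X n c \<longleftrightarrow> (case c of (U, \<phi>) \<Rightarrow>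
     openin X U \<and> openin (Euclidean_space n) (\<phi> ` U) \<and>
     homeomorphic_map (subtopology X U) (subtopology (Euclidean_space n) (\<phi> ` U)) \<phi>)"

definition smooth_in_charts ::
    "nat \<Rightarrow> 'a chart set \<Rightarrow> nat \<Rightarrow> 'b chart set \<Rightarrow> ('a \<Rightarrow> 'b) \<Rightarrow> bool" where
  "smooth_in_charts m A n B f \<longleftrightarrow> (\<forall>(U, \<phi>)\<in>A. \<forall>(V, \<psi>)\<in>B.
     C_infinity_on m n (\<phi> ` (U \<inter> f -` V)) (\<psi> \<circ> f \<circ> inv_into U \<phi>))"

text \<open>The atlas is not required to be maximal.\<close>

definition smooth_manifold :: "'a topology \<Rightarrow> nat \<Rightarrow> 'a chart set \<Rightarrow> bool" where
  "smooth_manifold X n A \<longleftrightarrow> Hausdorff_space X \<and> second_countable X \<and>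
     (\<forall>c\<in>A. chart_on X n c) \<and> \<Union> (fst ` A) = topspace X \<and>
     smooth_in_charts n A n A (\<lambda>x. x)"

definition smooth_map ::
    "'a topology \<Rightarrow> nat \<Rightarrow> 'a chart set \<Rightarrow> 'b topology \<Rightarrow> nat \<Rightarrow> 'b chart set \<Rightarrow> ('a \<Rightarrow> 'b) \<Rightarrow> bool"
  where
  "smooth_map X m A Y n B f \<longleftrightarrow> continuous_map X Y f \<and> smooth_in_charts m A n B f"

text \<open>The identification of \<open>\<real>\<^sup>m \<times> \<real>\<^sup>n\<close> with \<open>\<real>\<^sup>m\<^sup>+\<^sup>n\<close>, and the resulting atlas on a product.\<close>

definition concat_coords :: "nat \<Rightarrow> (nat \<Rightarrow> real) \<Rightarrow> (nat \<Rightarrow> real) \<Rightarrow> nat \<Rightarrow> real" where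
  "concat_coords m x y = (\<lambda>i. if i < m then x i else y (i - m))"

definition product_atlas :: "nat \<Rightarrow> 'a chart set \<Rightarrow> 'b chart set \<Rightarrow> ('a \<times> 'b) chart set" where
  "product_atlas m A B =
     (\<lambda>((U, \<phi>), (V, \<psi>)). (U \<times> V, \<lambda>(x, y). concat_coords m (\<phi> x) (\<psi> y))) ` (A \<times> B)"

definition lie_group :: "('g, 'm) monoid_scheme \<Rightarrow> 'g topology \<Rightarrow> nat \<Rightarrow> 'g chart set \<Rightarrow> bool" where
  "lie_group G T d A \<longleftrightarrow> group G \<and> topspace T = carrier G \<and> smooth_manifold T d A \<and>
     smooth_map (prod_topology T T) (d + d) (product_atlas d A A) T d A (\<lambda>(x, y). x \<otimes>\<^bsub>G\<^esub> y) \<and>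
     smooth_map T d A T d A (\<lambda>x. inv\<^bsub>G\<^esub> x)"

definition compact_lie_group ::
    "('g, 'm) monoid_scheme \<Rightarrow> 'g topology \<Rightarrow> nat \<Rightarrow> 'g chart set \<Rightarrow> bool" where
  "compact_lie_group G T d A \<longleftrightarrow> lie_group G T d A \<and> compact_space T"


section \<open>A universal host for finite dimensional inner product spaces\<close>

text \<open>
  The inner product space of finitely supported real sequences. Every finite dimensional real
  inner product space, the zero space included, is isometric to a subspace of it, so quantifying
  existentially over its finite dimensional subspaces amounts to quantifying over all finite
  dimensional real inner product spaces (HOL has no existential quantifier over types).
\<close>

typedef fin_seq = "{f :: nat \<Rightarrow> real. finite {i. f i \<noteq> 0}}"
  morphisms seq_nth Abs_fin_seq
  by (rule exI[of _ "\<lambda>_. 0"]) simp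

setup_lifting type_definition_fin_seq

lemma finite_support_seq_nth: "finite {i. seq_nth x i \<noteq> 0}"
  using seq_nth[of x] by simp

lemma fin_seq_eqI: "(\<And>i. seq_nth x i = seq_nth y i) \<Longrightarrow> x = y"
  by (simp add: seq_nth_inject[symmetric] fun_eq_iff)

instantiation fin_seq :: real_vector
begin

lift_definition zero_fin_seq :: fin_seq is "\<lambda>_. 0"
  by simp

lift_definition plus_fin_seq :: "fin_seq \<Rightarrow> fin_seq \<Rightarrow> fin_seq" is "\<lambda>f g i. f i + g i"
  subgoal for f g
    by (rule finite_subset[of _ "{i. f i \<noteq> 0} \<union> {i. g i \<noteq> 0}"]) auto
  done

lift_definition minus_fin_seq :: "fin_seq \<Rightarrow> fin_seq \<Rightarrow> fin_seq" is "\<lambda>f g i. f i - g i"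
  subgoal for f g
    by (rule finite_subset[of _ "{i. f i \<noteq> 0} \<union> {i. g i \<noteq> 0}"]) auto
  done

lift_definition uminus_fin_seq :: "fin_seq \<Rightarrow> fin_seq" is "\<lambda>f i. - f i"
  by simp

lift_definition scaleR_fin_seq :: "real \<Rightarrow> fin_seq \<Rightarrow> fin_seq" is "\<lambda>c f i. c * f i"
  subgoal for c f
    by (rule finite_subset[of _ "{i. f i \<noteq> 0}"]) auto
  done

instance
  by standard (transfer; simp add: fun_eq_iff algebra_simps)+

end

instantiation fin_seq :: real_inner
begin

definition inner_fin_seq :: "fin_seq \<Rightarrow> fin_seq \<Rightarrow> real" where
  "inner_fin_seq x y = (\<Sum>i | seq_nth x i \<noteq> 0. seq_nth x i * seq_nth y i)"

definition norm_fin_seq :: "fin_seq \<Rightarrow> real" where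
  "norm_fin_seq x = sqrt (inner x x)"

definition dist_fin_seq :: "fin_seq \<Rightarrow> fin_seq \<Rightarrow> real" where
  "dist_fin_seq x y = norm (x - y)"

definition sgn_fin_seq :: "fin_seq \<Rightarrow> fin_seq" where
  "sgn_fin_seq x = x /\<^sub>R norm x"

definition uniformity_fin_seq :: "(fin_seq \<times> fin_seq) filter" where
  "uniformity_fin_seq = (INF e\<in>{0 <..}. principal {(x, y). dist x y < e})"

definition open_fin_seq :: "fin_seq set \<Rightarrow> bool" where
  "open_fin_seq U \<longleftrightarrow> (\<forall>x\<in>U. eventually (\<lambda>(x', y). x' = x \<longrightarrow> y \<in> U) uniformity)"

lemma inner_fin_seq_superset:
  assumes "finite I" "{i. seq_nth x i \<noteq> 0} \<subseteq> I"
  shows "inner x y = (\<Sum>i\<in>I. seq_nth x i * seq_nth y i)"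
  unfolding inner_fin_seq_def using assms by (intro sum.mono_neutral_left) auto

instance
proof
  fix x y z :: fin_seq and r :: real
  let ?I = "{i. seq_nth x i \<noteq> 0} \<union> {i. seq_nth y i \<noteq> 0}"
  have I: "finite ?I"
    by (simp add: finite_support_seq_nth)
  have x: "inner x w = (\<Sum>i\<in>?I. seq_nth x i * seq_nth w i)" for w
    using I by (intro inner_fin_seq_superset) auto
  have y: "inner y w = (\<Sum>i\<in>?I. seq_nth y i * seq_nth w i)" for w
    using I by (intro inner_fin_seq_superset) auto
  show "inner x y = inner y x"
    unfolding x y by (simp add: mult.commute)
  have "inner (x + y) z = (\<Sum>i\<in>?I. seq_nth (x + y) i * seq_nth z i)"
    using I by (intro inner_fin_seq_superset) (auto simp: plus_fin_seq.rep_eq)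
  then show "inner (x + y) z = inner x z + inner y z"
    unfolding x y by (simp add: plus_fin_seq.rep_eq distrib_right sum.distrib)
  have "inner (r *\<^sub>R x) y = (\<Sum>i\<in>?I. seq_nth (r *\<^sub>R x) i * seq_nth y i)"
    using I by (intro inner_fin_seq_superset) (auto simp: scaleR_fin_seq.rep_eq)
  then show "inner (r *\<^sub>R x) y = r * inner x y"
    unfolding x by (simp add: scaleR_fin_seq.rep_eq sum_distrib_left mult.assoc)
  show "0 \<le> inner x x"
    unfolding inner_fin_seq_def by (intro sum_nonneg) simp
  show "inner x x = 0 \<longleftrightarrow> x = 0"
  proof
    assume "inner x x = 0"
    then have "seq_nth x i * seq_nth x i = 0" if "seq_nth x i \<noteq> 0" for i
      using that finite_support_seq_nth[of x] unfolding inner_fin_seq_def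
      by (subst (asm) sum_nonneg_eq_0_iff) auto
    then show "x = 0"
      by (intro fin_seq_eqI) (auto simp: zero_fin_seq.rep_eq)
  qed (simp add: inner_fin_seq_def zero_fin_seq.rep_eq)
qed (rule norm_fin_seq_def dist_fin_seq_def sgn_fin_seq_def uniformity_fin_seq_def
      open_fin_seq_def)+

end


section \<open>Orthogonal representations\<close>

text \<open>
  A finite dimensional real inner product space is a finite dimensional subspace of a type of
  class \<open>real_inner\<close>, with the inner product and topology of the type.
\<close>

definition linear_isometry_on :: "'v::real_inner set \<Rightarrow> ('v \<Rightarrow> 'w::real_inner) \<Rightarrow> bool" where
  "linear_isometry_on V f \<longleftrightarrow>
     (\<forall>x\<in>V. \<forall>y\<in>V. f (x + y) = f x + f y) \<and>
     (\<forall>c. \<forall>x\<in>V. f (c *\<^sub>R x) = c *\<^sub>R f x) \<and>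
     (\<forall>x\<in>V. \<forall>y\<in>V. inner (f x) (f y) = inner x y)"

definition orthogonal_representation ::
    "('g, 'm) monoid_scheme \<Rightarrow> 'g topology \<Rightarrow> 'v::real_inner set \<Rightarrow> ('g \<Rightarrow> 'v \<Rightarrow> 'v) \<Rightarrow> bool"
  where
  "orthogonal_representation G T V \<rho> \<longleftrightarrow>
     subspace V \<and> (\<exists>B. finite B \<and> span B = V) \<and>
     group_action G V \<rho> \<and> (\<forall>g\<in>carrier G. linear_isometry_on V (\<rho> g)) \<and>
     continuous_map (prod_topology T (top_of_set V)) (top_of_set V) (\<lambda>(g, v). \<rho> g v)"

definition fixed_space :: "'g set \<Rightarrow> 'v set \<Rightarrow> ('g \<Rightarrow> 'v \<Rightarrow> 'v) \<Rightarrow> 'v set" where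
  "fixed_space N V \<rho> = {v \<in> V. \<forall>n\<in>N. \<rho> n v = v}"

text \<open>
  The type argument is the host of the \<open>N\<close>-representations \<open>W\<close>; quantification over all
  \<open>W\<close> is obtained by leaving it a type variable. The restriction of \<open>(V, \<rho>)\<close> to \<open>N\<close> is again
  \<open>(V, \<rho>)\<close>, with \<open>\<rho>\<close> only evaluated on \<open>N\<close>. As \<open>f\<close> is a linear isometry, bijectivity on
  fixed spaces makes it an isomorphism there.
\<close>

definition orthogonally_final ::
    "'w::real_inner itself \<Rightarrow> ('g, 'm) monoid_scheme \<Rightarrow> 'g topology \<Rightarrow> 'g set \<Rightarrow> bool" where
  "orthogonally_final TW G T N \<longleftrightarrow>
     (\<forall>(W :: 'w set) \<sigma>.
        orthogonal_representation (G\<lparr>carrier := N\<rparr>) (subtopology T N) W \<sigma> \<longrightarrow>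
        (\<exists>(V :: fin_seq set) \<rho> f.
           orthogonal_representation G T V \<rho> \<and>
           f \<in> W \<rightarrow> V \<and> linear_isometry_on W f \<and>
           (\<forall>n\<in>N. \<forall>w\<in>W. f (\<sigma> n w) = \<rho> n (f w)) \<and>
           bij_betw f (fixed_space N W \<sigma>) (fixed_space N V \<rho>)))"

end

theory Submission
  imports Defs
begin

text \<open>
  Split \<open>W\<close> orthogonally as \<open>W\<^sup>N \<oplus> U\<close>, let \<open>G\<close> act trivially on \<open>W\<^sup>N\<close>, and take \<open>V\<close> to be the sum of
  \<open>W\<^sup>N\<close> and the representation induced from \<open>U\<close>. As \<open>N\<close> is normal, it preserves every summand of
  the induced representation and acts there by a conjugate of \<open>U\<close>, so that no nonzero vector
  is fixed and \<open>V\<^sup>N = W\<^sup>N\<close>. The action is continuous because a closed subgroup of finite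
  index is open.
\<close>

section \<open>Finite dimensional subspaces\<close>

text \<open>Finite dimension is expressed by \<open>S \<subseteq> span B\<close>, where
  \<open>B\<close> may lie outside \<open>S\<close>. It bounds the size of a maximal independent
  subset of \<open>S\<close>, which is then orthogonalised and normalised.\<close>

lemma finite_dim_orthonormal_basis:
  fixes S :: "'a::real_inner set"
  assumes S: "subspace S" and B: "finite B" "S \<subseteq> span B"
  obtains C where "finite C" "span C = S" "\<And>x y. x \<in> C \<Longrightarrow> y \<in> C \<Longrightarrow> inner x y = (if x = y then 1 else 0)"
proof -
  obtain D where D: "D \<subseteq> S" "independent D" "S \<subseteq> span D"
    using maximal_independent_subset by blast
  have "finite D"
    using independent_span_bound[OF B(1) D(2)] D(1) B(2) by blast
  then obtain C where C: "finite C" "span C = span D" "pairwise orthogonal C"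
    using basis_orthogonal by blast
  have span_D: "span D = S"
    using D S by (intro subset_antisym span_minimal)
  \<comment> \<open>The facts obtained on \<open>C\<close> do not exclude the zero vector, so it is
    removed before normalising.\<close>
  define E where "E = sgn ` (C - {0})"
  show thesis
  proof
    show "finite E"
      using C(1) by (simp add: E_def)
    have "E \<subseteq> span C"
      by (auto simp: E_def sgn_div_norm intro: span_mul span_base)
    moreover have "C \<subseteq> span E"
    proof
      fix x assume "x \<in> C"
      show "x \<in> span E"
      proof (cases "x = 0")
        case False
        then have "sgn x \<in> span E"
          using \<open>x \<in> C\<close> by (auto simp: E_def intro: span_base)
        then have "norm x *\<^sub>R sgn x \<in> span E"
          by (rule span_mul)
        then show ?thesis
          using False by (simp add: sgn_div_norm)
      qed (simp add: span_zero)
    qed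
    ultimately have "span E = span C"
      by (simp add: span_eq)
    then show "span E = S"
      using C(2) span_D by simp
    fix x y assume "x \<in> E" "y \<in> E"
    then obtain u v where uv: "u \<in> C" "v \<in> C" "u \<noteq> 0" "v \<noteq> 0" "x = sgn u" "y = sgn v"
      by (auto simp: E_def)
    show "inner x y = (if x = y then 1 else 0)"
    proof (cases "u = v")
      case True
      then show ?thesis
        using uv by (simp add: sgn_div_norm dot_square_norm power2_eq_square)
    next
      case False
      then have "inner x y = 0"
        using C(3) uv by (simp add: pairwise_def orthogonal_def sgn_div_norm)
      moreover have "inner y y = 1"
        using uv by (simp add: sgn_div_norm dot_square_norm power2_eq_square)
      ultimately show ?thesis
        by auto
    qed
  qed
qed

text \<open>Both sides are linear in \<open>x\<close>, so induction over the span reduces to a basis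
  vector, where orthonormality leaves a single term.\<close>

lemma orthonormal_expansion:
  fixes x :: "'a::real_inner"
  assumes C: "finite C" "\<And>x y. x \<in> C \<Longrightarrow> y \<in> C \<Longrightarrow> inner x y = (if x = y then 1 else 0)"
    and x: "x \<in> span C"
  shows "(\<Sum>c\<in>C. inner x c *\<^sub>R c) = x"
  using x
proof (induction rule: span_induct_alt)
  case base
  then show ?case by simp
next
  case (step a b y)
  have "(\<Sum>d\<in>C. inner b d *\<^sub>R d) = (\<Sum>d\<in>C. if d = b then d else 0)"
    using C(2) step(1) by (intro sum.cong) auto
  also have "\<dots> = b"
    using C(1) step(1) by simp
  finally have b: "(\<Sum>d\<in>C. inner b d *\<^sub>R d) = b" .
  have "(\<Sum>d\<in>C. inner (a *\<^sub>R b + y) d *\<^sub>R d)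
      = a *\<^sub>R (\<Sum>d\<in>C. inner b d *\<^sub>R d) + (\<Sum>d\<in>C. inner y d *\<^sub>R d)"
    by (simp add: inner_add_left scaleR_add_left sum.distrib scaleR_sum_right)
  then show ?case
    using b step(2) by simp
qed

text \<open>The expansion in an orthonormal basis of \<open>S\<close> makes sense for every vector
  of the type. Self-adjointness is what makes this projection the orthogonal one.\<close>

lemma orthogonal_projection_exists:
  fixes S :: "'a::real_inner set"
  assumes "subspace S" "finite B" "S \<subseteq> span B"
  obtains p where "bounded_linear p" "\<And>x. p x \<in> S" "\<And>x. x \<in> S \<Longrightarrow> p x = x"
    "\<And>x y. inner (p x) y = inner x (p y)"
proof -
  obtain C where C: "finite C" "span C = S"
    "\<And>x y. x \<in> C \<Longrightarrow> y \<in> C \<Longrightarrow> inner x y = (if x = y then 1 else 0)"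
    using finite_dim_orthonormal_basis assms by blast
  show thesis
  proof
    show "bounded_linear (\<lambda>x. \<Sum>c\<in>C. inner x c *\<^sub>R c)"
      by (intro bounded_linear_intros)
    show "(\<Sum>c\<in>C. inner x c *\<^sub>R c) \<in> S" for x
      unfolding C(2)[symmetric] by (intro span_sum span_mul span_base)
    show "(\<Sum>c\<in>C. inner x c *\<^sub>R c) = x" if "x \<in> S" for x
      using orthonormal_expansion[OF C(1,3)] that C(2) by simp
    show "inner (\<Sum>c\<in>C. inner x c *\<^sub>R c) y = inner x (\<Sum>c\<in>C. inner y c *\<^sub>R c)" for x y
      by (simp add: inner_sum_left inner_sum_right inner_commute mult.commute)
  qed
qed

section \<open>Orthogonal copies inside the finitely supported sequences\<close>

lift_definition unit_seq :: "nat \<Rightarrow> fin_seq" is "\<lambda>i j. if j = i then 1 else 0"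
  by simp

lemma inner_unit_seq: "inner (unit_seq i) (unit_seq j) = (if i = j then 1 else 0)"
  by (subst inner_fin_seq_superset[of "{i}"]) (auto simp: unit_seq.rep_eq)

text \<open>Pairs of an index in \<open>R\<close> and an orthonormal basis vector of
  \<open>W\<close> are numbered injectively, and \<open>e r\<close> sends the basis vector
  \<open>c\<close> to the unit sequence numbered by \<open>(r, c)\<close>. Copies with different
  indices in \<open>R\<close> are thus orthogonal, and \<open>W\<close> moves from an arbitrary host
  into \<open>fin_seq\<close>.\<close>

lemma orthogonal_copies:
  fixes W :: "'w::real_inner set" and R :: "'r set"
  assumes W: "subspace W" "finite B" "span B = W" and R: "finite R"
  obtains e :: "'r \<Rightarrow> 'w \<Rightarrow> fin_seq" and a
  where "\<And>r. bounded_linear (e r)" "\<And>r. bounded_linear (a r)" "\<And>r v. a r v \<in> W"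
    "\<And>r s w. r \<in> R \<Longrightarrow> s \<in> R \<Longrightarrow> w \<in> W \<Longrightarrow> a r (e s w) = (if r = s then w else 0)"
    "\<And>r w v. inner (e r w) v = inner w (a r v)"
proof -
  obtain C where C: "finite C" "span C = W"
    "\<And>x y. x \<in> C \<Longrightarrow> y \<in> C \<Longrightarrow> inner x y = (if x = y then 1 else 0)"
    using finite_dim_orthonormal_basis[OF W(1,2)] W(3) by blast
  obtain i :: "'r \<times> 'w \<Rightarrow> nat" where i: "inj_on i (R \<times> C)"
    using finite_imp_inj_to_nat_seg[of "R \<times> C"] C(1) R by auto
  define u where "u r c = unit_seq (i (r, c))" for r c
  have u: "inner (u r b) (u s c) = (if r = s \<and> b = c then 1 else 0)"
    if "r \<in> R" "s \<in> R" "b \<in> C" "c \<in> C" for r s b c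
    using that i by (auto simp: u_def inner_unit_seq inj_on_def)
  let ?e = "\<lambda>r w. \<Sum>c\<in>C. inner w c *\<^sub>R u r c" and ?a = "\<lambda>r v. \<Sum>c\<in>C. inner v (u r c) *\<^sub>R c"
  show thesis
  proof
    show "bounded_linear (?e r)" "bounded_linear (?a r)" for r
      by (intro bounded_linear_intros)+
    show "?a r v \<in> W" for r v
      unfolding C(2)[symmetric] by (intro span_sum span_mul span_base)
    show "inner (?e r w) v = inner w (?a r v)" for r w v
      by (simp add: inner_sum_left inner_sum_right inner_commute mult.commute)
    show "?a r (?e s w) = (if r = s then w else 0)" if "r \<in> R" "s \<in> R" "w \<in> W" for r s w
    proof -
      have "inner (?e s w) (u r c) = (if r = s then inner w c else 0)" if "c \<in> C" for c
      proof -
        have "inner (?e s w) (u r c) = (\<Sum>b\<in>C. if b = c then (if r = s then inner w c else 0) else 0)"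
          unfolding inner_sum_left using u \<open>r \<in> R\<close> \<open>s \<in> R\<close> that by (intro sum.cong) auto
        then show ?thesis
          using C(1) that by simp
      qed
      then have "?a r (?e s w) = (if r = s then \<Sum>c\<in>C. inner w c *\<^sub>R c else 0)"
        by simp
      then show ?thesis
        using orthonormal_expansion[OF C(1,3)] that C(2) by simp
    qed
  qed
qed

section \<open>Group actions and transversals\<close>

text \<open>An action is a homomorphism into \<open>BijGroup V\<close>, whose elements are
  extensional; hence the premise \<open>ext\<close>. Bijectivity comes from the inverse group
  element.\<close>

lemma group_actionI:
  assumes "group G"
    and ext: "\<And>g. g \<in> carrier G \<Longrightarrow> \<rho> g \<in> extensional V"
    and closed: "\<And>g v. g \<in> carrier G \<Longrightarrow> v \<in> V \<Longrightarrow> \<rho> g v \<in> V"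
    and one: "\<And>v. v \<in> V \<Longrightarrow> \<rho> \<one>\<^bsub>G\<^esub> v = v"
    and mult: "\<And>g h v. g \<in> carrier G \<Longrightarrow> h \<in> carrier G \<Longrightarrow> v \<in> V \<Longrightarrow> \<rho> (g \<otimes>\<^bsub>G\<^esub> h) v = \<rho> g (\<rho> h v)"
  shows "group_action G V \<rho>"
proof -
  interpret group G by fact
  have Bij: "\<rho> g \<in> Bij V" if "g \<in> carrier G" for g
  proof -
    have "\<rho> (inv\<^bsub>G\<^esub> g) (\<rho> g v) = v" "\<rho> g (\<rho> (inv\<^bsub>G\<^esub> g) v) = v" if "v \<in> V" for v
      using mult[of "inv\<^bsub>G\<^esub> g" g v] mult[of g "inv\<^bsub>G\<^esub> g" v] one that \<open>g \<in> carrier G\<close> by auto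
    then have "bij_betw (\<rho> g) V V"
      using closed that by (intro bij_betw_byWitness[where f' = "\<rho> (inv\<^bsub>G\<^esub> g)"]) auto
    then show ?thesis
      using ext that by (simp add: Bij_def)
  qed
  have "\<rho> (g \<otimes>\<^bsub>G\<^esub> h) = \<rho> g \<otimes>\<^bsub>BijGroup V\<^esub> \<rho> h" if "g \<in> carrier G" "h \<in> carrier G" for g h
  proof (rule extensionalityI[of _ V])
    show "\<rho> (g \<otimes>\<^bsub>G\<^esub> h) \<in> extensional V"
      using that ext by simp
  qed (use that Bij mult in \<open>auto simp: BijGroup_def compose_def\<close>)
  then show ?thesis
    unfolding group_action_def using Bij
    by (intro group_hom.intro group_hom_axioms.intro homI group_BijGroup is_group)
      (auto simp: BijGroup_def)
qed

text \<open>One representative is chosen in each right coset. By normality left and right cosets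
  agree, so the same representatives satisfy the left condition
  \<open>inv r \<otimes> g \<in> H\<close>.\<close>

lemma (in normal) finite_transversal:
  assumes "finite (rcosets H)"
  obtains R where "finite R" "R \<subseteq> carrier G" "\<one> \<in> R"
    "\<And>g. g \<in> carrier G \<Longrightarrow> \<exists>!r. r \<in> R \<and> inv r \<otimes> g \<in> H"
proof -
  \<comment> \<open>Choice alone would not guarantee \<open>\<one> \<in> R\<close>, so the coset
    \<open>H\<close> gets its representative by hand.\<close>
  define c where "c K = (if K = H then \<one> else SOME x. x \<in> K)" for K
  have c: "c K \<in> K" if "K \<in> rcosets H" for K
    using rcosets_non_empty[OF that] by (auto simp: c_def some_in_eq)
  have c_carrier: "c K \<in> carrier G" if "K \<in> rcosets H" for K
    using c[OF that] rcosets_carrier[OF is_group that] by blast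
  have coset: "H #> g = K" if K: "K \<in> rcosets H" "g \<in> K" for K g
  proof -
    obtain x where "x \<in> carrier G" "K = H #> x"
      using K(1) by (auto simp: RCOSETS_def)
    then show ?thesis
      using repr_independence[OF _ _ is_subgroup, of g x] K(2) by simp
  qed
  have mem: "inv (c K) \<otimes> g \<in> H \<longleftrightarrow> g \<in> K" if K: "K \<in> rcosets H" and g: "g \<in> carrier G" for K g
  proof -
    have "H #> c K = K"
      using c[OF K] K coset by blast
    then have "g \<in> K \<longleftrightarrow> g \<otimes> inv (c K) \<in> H"
      using rcos_module[OF is_group c_carrier[OF K] g] by simp
    \<comment> \<open>Conjugation by \<open>c K\<close> turns one product into the other, and it
      preserves the normal subgroup \<open>H\<close>.\<close>
    also have "\<dots> \<longleftrightarrow> inv (c K) \<otimes> g \<in> H"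
    proof
      assume "g \<otimes> inv (c K) \<in> H"
      then have "inv (c K) \<otimes> (g \<otimes> inv (c K)) \<otimes> c K \<in> H"
        using c_carrier[OF K] by (rule inv_op_closed1[rotated])
      then show "inv (c K) \<otimes> g \<in> H"
        using c_carrier[OF K] g by (simp add: m_assoc)
    next
      assume "inv (c K) \<otimes> g \<in> H"
      then have "c K \<otimes> (inv (c K) \<otimes> g) \<otimes> inv (c K) \<in> H"
        using c_carrier[OF K] by (rule inv_op_closed2[rotated])
      then show "g \<otimes> inv (c K) \<in> H"
        using c_carrier[OF K] g by (simp add: m_assoc[symmetric])
    qed
    finally show ?thesis
      by simp
  qed
  have H: "H \<in> rcosets H"
    using subgroup_in_rcosets[OF is_group] .
  show thesis
  proof
    show "finite (c ` (rcosets H))"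
      using assms by simp
    show "c ` (rcosets H) \<subseteq> carrier G"
      using c_carrier by blast
    show "\<one> \<in> c ` (rcosets H)"
      using H by (rule rev_image_eqI) (simp add: c_def)
    fix g assume g: "g \<in> carrier G"
    have K: "H #> g \<in> rcosets H" "g \<in> H #> g"
      using g rcosetsI[OF subset g] rcos_self[OF g is_subgroup] by auto
    show "\<exists>!r. r \<in> c ` (rcosets H) \<and> inv r \<otimes> g \<in> H"
    proof (intro ex1I conjI)
      show "c (H #> g) \<in> c ` (rcosets H)" "inv (c (H #> g)) \<otimes> g \<in> H"
        using K mem[OF K(1) g] by auto
      fix r assume r: "r \<in> c ` (rcosets H) \<and> inv r \<otimes> g \<in> H"
      then obtain K' where "K' \<in> rcosets H" "r = c K'"
        by blast
      with r show "r = c (H #> g)"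
        using mem[OF _ g] coset by blast
    qed
  qed
qed

lemma (in group) mult_inv_mult_cancel:
  "x \<in> carrier G \<Longrightarrow> y \<in> carrier G \<Longrightarrow> x \<otimes> (inv x \<otimes> y) = y"
  "x \<in> carrier G \<Longrightarrow> y \<in> carrier G \<Longrightarrow> inv x \<otimes> (x \<otimes> y) = y"
  using m_assoc[of x "inv x" y] m_assoc[of "inv x" x y] by simp_all

section \<open>The induced representation\<close>

text \<open>
  Here \<open>e r\<close> embeds \<open>W\<close> as the summand indexed by the coset \<open>r N\<close>, \<open>a r\<close> is its adjoint, and \<open>p\<close>
  is the orthogonal projection of \<open>W\<close> onto its \<open>N\<close>-fixed vectors.
\<close>

locale induced_representation = normal N G for N and G (structure) +
  fixes R :: "'a set" and W :: "'w::real_inner set" and \<sigma> :: "'a \<Rightarrow> 'w \<Rightarrow> 'w" and p :: "'w \<Rightarrow> 'w"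
    and e :: "'a \<Rightarrow> 'w \<Rightarrow> 'v::real_inner" and a :: "'a \<Rightarrow> 'v \<Rightarrow> 'w"
  assumes R: "finite R" "R \<subseteq> carrier G" "\<one> \<in> R"
    and R_unique: "\<And>g. g \<in> carrier G \<Longrightarrow> \<exists>!r. r \<in> R \<and> inv r \<otimes> g \<in> N"
    and W: "subspace W" "\<exists>B. finite B \<and> span B = W"
    and \<sigma>_closed: "\<And>n w. n \<in> N \<Longrightarrow> w \<in> W \<Longrightarrow> \<sigma> n w \<in> W"
    and \<sigma>_one: "\<And>w. w \<in> W \<Longrightarrow> \<sigma> \<one> w = w"
    and \<sigma>_mult: "\<And>m n w. m \<in> N \<Longrightarrow> n \<in> N \<Longrightarrow> w \<in> W \<Longrightarrow> \<sigma> (m \<otimes> n) w = \<sigma> m (\<sigma> n w)"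
    and \<sigma>_isometry: "\<And>n. n \<in> N \<Longrightarrow> linear_isometry_on W (\<sigma> n)"
    and p: "bounded_linear p" "\<And>x. p x \<in> fixed_space N W \<sigma>"
      "\<And>x. x \<in> fixed_space N W \<sigma> \<Longrightarrow> p x = x" "\<And>x y. inner (p x) y = inner x (p y)"
    and e: "\<And>r. bounded_linear (e r)"
    and a: "\<And>r. bounded_linear (a r)" "\<And>r v. a r v \<in> W"
    and a_e: "\<And>r s w. r \<in> R \<Longrightarrow> s \<in> R \<Longrightarrow> w \<in> W \<Longrightarrow> a r (e s w) = (if r = s then w else 0)"
    and e_adjoint: "\<And>r w v. inner (e r w) v = inner w (a r v)"
begin

sublocale e: bounded_linear "e r" for r by (rule e)
sublocale a: bounded_linear "a r" for r by (rule a)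
sublocale p: bounded_linear p by (rule p)

section \<open>The action of \<open>N\<close> on \<open>W\<close> and its extension by zero\<close>

lemma R_carrier [simp]: "r \<in> R \<Longrightarrow> r \<in> carrier G"
  using R by blast

lemma N_carrier [simp]: "n \<in> N \<Longrightarrow> n \<in> carrier G"
  using subset by blast

lemma R_eqI: "r \<in> R \<Longrightarrow> s \<in> R \<Longrightarrow> inv r \<otimes> s \<in> N \<Longrightarrow> r = s"
  using R_unique[of s] by auto

lemma p_W [simp]: "p x \<in> W"
  using p(2) by (simp add: fixed_space_def)

lemma \<sigma>_p: "n \<in> N \<Longrightarrow> \<sigma> n (p x) = p x"
  using p(2) by (simp add: fixed_space_def)

lemma p_p [simp]: "p (p x) = p x"
  using p(2,3) by blast

lemma \<sigma>_add: "n \<in> N \<Longrightarrow> x \<in> W \<Longrightarrow> y \<in> W \<Longrightarrow> \<sigma> n (x + y) = \<sigma> n x + \<sigma> n y"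
  and \<sigma>_scaleR: "n \<in> N \<Longrightarrow> x \<in> W \<Longrightarrow> \<sigma> n (c *\<^sub>R x) = c *\<^sub>R \<sigma> n x"
  and \<sigma>_inner: "n \<in> N \<Longrightarrow> x \<in> W \<Longrightarrow> y \<in> W \<Longrightarrow> inner (\<sigma> n x) (\<sigma> n y) = inner x y"
  using \<sigma>_isometry by (simp_all add: linear_isometry_on_def)

lemma \<sigma>_zero: "n \<in> N \<Longrightarrow> \<sigma> n 0 = 0"
  using \<sigma>_scaleR[of n 0 0] subspace_0[OF W(1)] by simp

lemma \<sigma>_adjoint:
  assumes "n \<in> N" "x \<in> W" "y \<in> W"
  shows "inner (\<sigma> n x) y = inner x (\<sigma> (inv n) y)"
proof -
  have "\<sigma> n (\<sigma> (inv n) y) = y"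
    using \<sigma>_mult[of n "inv n" y] \<sigma>_one assms by simp
  then show ?thesis
    using \<sigma>_inner[of n x "\<sigma> (inv n) y"] \<sigma>_closed assms by simp
qed

text \<open>The isometry \<open>\<sigma> n\<close> fixes \<open>p z\<close>, so
  \<open>z = \<sigma> n w - w\<close> is orthogonal to \<open>p z\<close>. As \<open>p\<close> is a
  self-adjoint idempotent, \<open>p z\<close> is then orthogonal to itself.\<close>

lemma p_\<sigma>:
  assumes n: "n \<in> N" and w: "w \<in> W"
  shows "p (\<sigma> n w) = p w"
proof -
  define z where "z = \<sigma> n w - w"
  have "inner (\<sigma> n w) (p z) = inner w (p z)"
    using \<sigma>_inner[OF n w p_W] \<sigma>_p[OF n] by metis
  then have "inner (p z) (p z) = 0"
    by (subst p(4)) (simp add: z_def inner_diff_left)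
  then show ?thesis
    by (simp add: z_def p.diff)
qed

text \<open>The action of \<open>N\<close> on the orthogonal complement of the fixed vectors,
  precomposed with the projection to that complement and extended by zero to arguments outside
  \<open>N\<close>. Its values serve as the blocks of the induced representation, and the zeros
  replace case distinctions on cosets.\<close>

definition \<tau> :: "'a \<Rightarrow> 'w \<Rightarrow> 'w" where
  "\<tau> h w = (if h \<in> N then \<sigma> h (w - p w) else 0)"

lemma q_W [simp]: "w \<in> W \<Longrightarrow> w - p w \<in> W"
  using W by (simp add: subspace_diff)

lemma \<tau>_closed: "w \<in> W \<Longrightarrow> \<tau> h w \<in> W"
  by (simp add: \<tau>_def \<sigma>_closed subspace_0 W)

lemma \<tau>_add: "x \<in> W \<Longrightarrow> y \<in> W \<Longrightarrow> \<tau> h (x + y) = \<tau> h x + \<tau> h y"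
  using \<sigma>_add[of h "x - p x" "y - p y"] by (simp add: \<tau>_def p.add add_diff_add)

lemma \<tau>_scaleR: "x \<in> W \<Longrightarrow> \<tau> h (c *\<^sub>R x) = c *\<^sub>R \<tau> h x"
  using \<sigma>_scaleR[of h "x - p x" c] by (simp add: \<tau>_def p.scaleR scaleR_diff_right)

lemma \<tau>_zero [simp]: "\<tau> h 0 = 0"
  by (simp add: \<tau>_def \<sigma>_zero)

lemma \<tau>_p [simp]: "\<tau> h (p w) = 0"
  by (simp add: \<tau>_def \<sigma>_zero)

lemma \<tau>_sum: "(\<And>i. i \<in> I \<Longrightarrow> f i \<in> W) \<Longrightarrow> \<tau> h (sum f I) = (\<Sum>i\<in>I. \<tau> h (f i))"
proof (induction I rule: infinite_finite_induct)
  case (insert i I)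
  then show ?case
    using \<tau>_add[of "f i" "sum f I" h] subspace_sum[OF W(1), of I f] by simp
qed simp_all

lemma p_\<tau> [simp]: "w \<in> W \<Longrightarrow> p (\<tau> h w) = 0"
  by (simp add: \<tau>_def p_\<sigma> p.diff)

text \<open>For \<open>k \<in> N\<close> the elements \<open>h\<close> and
  \<open>h \<otimes> k\<close> lie in \<open>N\<close> together, so both sides vanish or neither is
  cut off. In the latter case the outer projection has no effect, as \<open>\<tau> k w\<close>
  already lies in the kernel of \<open>p\<close>.\<close>

lemma \<tau>_\<tau>:
  assumes "h \<in> carrier G" "k \<in> N" "w \<in> W"
  shows "\<tau> h (\<tau> k w) = \<tau> (h \<otimes> k) w"
proof -
  have "h \<otimes> k \<in> N \<longleftrightarrow> h \<in> N"
  proof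
    assume "h \<otimes> k \<in> N"
    then have "h \<otimes> k \<otimes> inv k \<in> N"
      using assms by simp
    then show "h \<in> N"
      using assms by (simp add: m_assoc)
  qed (use assms in simp)
  moreover have "\<tau> k w - p (\<tau> k w) = \<sigma> k (w - p w)"
    using assms by (simp add: \<tau>_def p_\<sigma>[of k "w - p w"] p.diff)
  ultimately show ?thesis
    using assms by (cases "h \<in> N") (simp_all add: \<tau>_def[of h] \<tau>_def[of "h \<otimes> k"] \<sigma>_mult del: p_\<tau>)
qed

text \<open>On \<open>N\<close> the inverse of an isometry is its adjoint, and the parts
  \<open>p x\<close> and \<open>p y\<close> are orthogonal to all values of \<open>\<tau>\<close>.
  Outside \<open>N\<close> both sides vanish, since \<open>N\<close> is closed under
  inverses.\<close>

lemma \<tau>_adjoint: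
  assumes "h \<in> carrier G" "x \<in> W" "y \<in> W"
  shows "inner (\<tau> h x) y = inner x (\<tau> (inv h) y)"
proof (cases "h \<in> N")
  case True
  have "inner (\<tau> h x) y = inner (\<tau> h x) (y - p y)"
    using p(4)[of "\<tau> h x" y] assms by (simp add: inner_diff_right)
  also have "\<dots> = inner (x - p x) (\<tau> (inv h) y)"
    using True assms by (simp add: \<tau>_def \<sigma>_adjoint)
  also have "\<dots> = inner x (\<tau> (inv h) y)"
    using p(4)[of x "\<tau> (inv h) y"] assms by (simp add: inner_diff_left)
  finally show ?thesis .
next
  case False
  then have "inv h \<notin> N"
    using assms(1) m_inv_closed[of "inv h"] by auto
  with False show ?thesis
    by (simp add: \<tau>_def)
qed

text \<open>This is the rule for multiplying block matrices. Only the representative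
  \<open>s\<close> of the coset of \<open>l\<close> gives a nonzero inner factor, and for it the
  factors \<open>s\<close> and \<open>inv s\<close> cancel.\<close>

lemma sum_\<tau>_\<tau>:
  assumes "k \<in> carrier G" "l \<in> carrier G" "w \<in> W"
  shows "(\<Sum>s\<in>R. \<tau> (k \<otimes> s) (\<tau> (inv s \<otimes> l) w)) = \<tau> (k \<otimes> l) w"
proof -
  obtain r where r: "r \<in> R" "inv r \<otimes> l \<in> N"
    and unique: "\<And>s. s \<in> R \<Longrightarrow> inv s \<otimes> l \<in> N \<Longrightarrow> s = r"
    using R_unique[OF assms(2)] by metis
  have "(\<Sum>s\<in>R. \<tau> (k \<otimes> s) (\<tau> (inv s \<otimes> l) w)) = (\<Sum>s\<in>{r}. \<tau> (k \<otimes> s) (\<tau> (inv s \<otimes> l) w))"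
  proof (intro sum.mono_neutral_right ballI)
    fix s assume "s \<in> R - {r}"
    then have "inv s \<otimes> l \<notin> N"
      using unique by blast
    then show "\<tau> (k \<otimes> s) (\<tau> (inv s \<otimes> l) w) = 0"
      by (simp add: \<tau>_def[of "inv s \<otimes> l"])
  qed (use R r in auto)
  also have "\<dots> = \<tau> (k \<otimes> r \<otimes> (inv r \<otimes> l)) w"
    using r assms by (simp add: \<tau>_\<tau>)
  also have "k \<otimes> r \<otimes> (inv r \<otimes> l) = k \<otimes> l"
    using r assms by (simp add: m_assoc mult_inv_mult_cancel)
  finally show ?thesis .
qed

text \<open>
  The trivial action of \<open>G\<close> on each copy of the fixed vectors, and the induced action on the copies
  of their orthogonal complement: \<open>\<tau> (inv r \<otimes> g \<otimes> s)\<close> vanishes unless \<open>g\<close> maps the coset of \<open>s\<close>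
  to that of \<open>r\<close>.
\<close>

definition ind_component :: "'a \<Rightarrow> 'v \<Rightarrow> 'a \<Rightarrow> 'w" where
  "ind_component g v r = p (a r v) + (\<Sum>s\<in>R. \<tau> (inv r \<otimes> g \<otimes> s) (a s v))"

definition ind :: "'a \<Rightarrow> 'v \<Rightarrow> 'v" where
  "ind g v = (\<Sum>r\<in>R. e r (ind_component g v r))"

text \<open>The first condition says that \<open>v\<close> lies in the sum of the copies of
  \<open>W\<close>. The second removes the fixed vectors from all copies but the one at
  \<open>\<one>\<close>, so that they occur exactly once.\<close>

definition ind_space :: "'v set" where
  "ind_space = {v. (\<Sum>r\<in>R. e r (a r v)) = v \<and> (\<forall>r\<in>R - {\<one>}. p (a r v) = 0)}"

section \<open>Linearity, multiplicativity and isometry of the induced operators\<close>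

lemma ind_component_W [simp]: "ind_component g v r \<in> W"
  by (simp add: ind_component_def subspace_add subspace_sum \<tau>_closed a W)

lemma a_sum_e:
  assumes "\<And>r. r \<in> R \<Longrightarrow> f r \<in> W" "s \<in> R"
  shows "a s (\<Sum>r\<in>R. e r (f r)) = f s"
proof -
  have "a s (\<Sum>r\<in>R. e r (f r)) = (\<Sum>r\<in>R. if s = r then f r else 0)"
    unfolding a.sum using assms by (intro sum.cong) (simp_all add: a_e)
  then show ?thesis
    using R assms by simp
qed

lemma a_ind: "s \<in> R \<Longrightarrow> a s (ind g v) = ind_component g v s"
  by (simp add: ind_def a_sum_e)

lemma p_ind_component [simp]: "p (ind_component g v r) = p (a r v)"
  by (simp add: ind_component_def p.add p.sum a)

text \<open>The blocks \<open>\<tau>\<close> take values in the kernel of \<open>p\<close>, so the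
  operator leaves every \<open>p (a r v)\<close> unchanged.\<close>

lemma ind_closed: "v \<in> ind_space \<Longrightarrow> ind g v \<in> ind_space"
  by (simp add: ind_space_def a_ind) (simp add: ind_def)

lemma subspace_ind_space: "subspace ind_space"
  by (auto simp: subspace_def ind_space_def e.add a.add p.add sum.distrib e.scaleR a.scaleR
      p.scaleR e.zero a.zero p.zero scaleR_sum_right[symmetric])

lemma ind_add: "ind g (x + y) = ind g x + ind g y"
proof -
  have "ind_component g (x + y) r = ind_component g x r + ind_component g y r" for r
    by (simp add: ind_component_def a.add p.add \<tau>_add a sum.distrib)
  then show ?thesis
    by (simp add: ind_def e.add sum.distrib)
qed

lemma ind_scaleR: "ind g (c *\<^sub>R x) = c *\<^sub>R ind g x"
proof -
  have "ind_component g (c *\<^sub>R x) r = c *\<^sub>R ind_component g x r" for r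
    by (simp add: ind_component_def a.scaleR p.scaleR \<tau>_scaleR a scaleR_sum_right scaleR_add_right)
  then show ?thesis
    by (simp add: ind_def e.scaleR scaleR_sum_right)
qed

text \<open>The trivial parts agree because \<open>p (a r v)\<close> is unchanged by the operators;
  the remaining parts multiply like block matrices.\<close>

lemma ind_mult:
  assumes "g \<in> carrier G" "h \<in> carrier G"
  shows "ind (g \<otimes> h) v = ind g (ind h v)"
proof -
  have "ind_component g (ind h v) r = ind_component (g \<otimes> h) v r" if r: "r \<in> R" for r
  proof -
    \<comment> \<open>The summand \<open>p (a s v)\<close> of the inner component is annihilated by
      \<open>\<tau>\<close>, so only the double sum survives.\<close>
    have "(\<Sum>s\<in>R. \<tau> (inv r \<otimes> g \<otimes> s) (a s (ind h v)))
        = (\<Sum>s\<in>R. \<Sum>t\<in>R. \<tau> (inv r \<otimes> g \<otimes> s) (\<tau> (inv s \<otimes> h \<otimes> t) (a t v)))"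
      by (intro sum.cong)
        (simp_all add: a_ind, simp add: ind_component_def \<tau>_add \<tau>_sum \<tau>_closed a subspace_sum W)
    also have "\<dots> = (\<Sum>t\<in>R. \<Sum>s\<in>R. \<tau> (inv r \<otimes> g \<otimes> s) (\<tau> (inv s \<otimes> (h \<otimes> t)) (a t v)))"
      by (subst sum.swap, intro sum.cong) (use assms in \<open>simp_all add: m_assoc\<close>)
    also have "\<dots> = (\<Sum>t\<in>R. \<tau> (inv r \<otimes> (g \<otimes> h) \<otimes> t) (a t v))"
    proof (intro sum.cong refl)
      fix t assume "t \<in> R"
      then show "(\<Sum>s\<in>R. \<tau> (inv r \<otimes> g \<otimes> s) (\<tau> (inv s \<otimes> (h \<otimes> t)) (a t v)))
          = \<tau> (inv r \<otimes> (g \<otimes> h) \<otimes> t) (a t v)"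
        using sum_\<tau>_\<tau>[of "inv r \<otimes> g" "h \<otimes> t" "a t v"] assms r a by (simp add: m_assoc)
    qed
    finally show ?thesis
      using r by (simp add: ind_component_def[of g] ind_component_def[of "g \<otimes> h"] a_ind)
  qed
  then show ?thesis
    by (simp add: ind_def[of g] ind_def[of "g \<otimes> h"])
qed

lemma \<tau>_one: "w \<in> W \<Longrightarrow> \<tau> \<one> w = w - p w"
  by (simp add: \<tau>_def \<sigma>_one)

text \<open>Elements of \<open>N\<close> act block-diagonally: by normality
  \<open>inv r \<otimes> n \<otimes> r\<close> lies in \<open>N\<close>, so a nonzero block at
  \<open>(r, s)\<close> would put \<open>inv r \<otimes> s\<close> in \<open>N\<close> and force
  \<open>r = s\<close>.\<close>

lemma ind_component_normal:
  assumes n: "n \<in> N" and r: "r \<in> R"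
  shows "ind_component n v r = p (a r v) + \<tau> (inv r \<otimes> n \<otimes> r) (a r v)"
proof -
  have "(\<Sum>s\<in>R. \<tau> (inv r \<otimes> n \<otimes> s) (a s v)) = (\<Sum>s\<in>{r}. \<tau> (inv r \<otimes> n \<otimes> s) (a s v))"
  proof (intro sum.mono_neutral_right ballI)
    fix s assume s: "s \<in> R - {r}"
    have "inv r \<otimes> n \<otimes> s \<notin> N"
    proof
      assume "inv r \<otimes> n \<otimes> s \<in> N"
      moreover have "inv (inv r \<otimes> n \<otimes> r) \<in> N"
        using n r by (simp add: inv_op_closed1)
      ultimately have "inv (inv r \<otimes> n \<otimes> r) \<otimes> (inv r \<otimes> n \<otimes> s) \<in> N"
        by simp
      also have "inv (inv r \<otimes> n \<otimes> r) \<otimes> (inv r \<otimes> n \<otimes> s) = inv r \<otimes> s"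
        using n r s by (simp add: inv_mult_group m_assoc mult_inv_mult_cancel)
      finally show False
        using R_eqI r s by blast
    qed
    then show "\<tau> (inv r \<otimes> n \<otimes> s) (a s v) = 0"
      by (simp add: \<tau>_def)
  qed (use R r in auto)
  then show ?thesis
    by (simp add: ind_component_def)
qed

lemma ind_one:
  assumes "v \<in> ind_space"
  shows "ind \<one> v = v"
proof -
  have "ind_component \<one> v r = a r v" if "r \<in> R" for r
    using that by (simp add: ind_component_normal \<tau>_one a)
  then show ?thesis
    using assms by (simp add: ind_def ind_space_def)
qed

text \<open>The inverse of \<open>inv r \<otimes> g \<otimes> s\<close> is
  \<open>inv s \<otimes> inv g \<otimes> r\<close>, so transposing the block matrix of
  \<open>g\<close> gives that of \<open>inv g\<close>.\<close>

lemma ind_adjoint: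
  assumes g: "g \<in> carrier G"
  shows "inner (ind g x) y = inner x (ind (inv g) y)"
proof -
  have "inner (ind g x) y = (\<Sum>r\<in>R. inner (ind_component g x r) (a r y))"
    by (simp add: ind_def inner_sum_left e_adjoint)
  also have "\<dots> = (\<Sum>r\<in>R. inner (p (a r x)) (a r y))
      + (\<Sum>r\<in>R. \<Sum>s\<in>R. inner (\<tau> (inv r \<otimes> g \<otimes> s) (a s x)) (a r y))"
    by (simp add: ind_component_def inner_add_left inner_sum_left sum.distrib)
  also have "(\<Sum>r\<in>R. inner (p (a r x)) (a r y)) = (\<Sum>r\<in>R. inner (a r x) (p (a r y)))"
    by (simp add: p(4))
  also have "(\<Sum>r\<in>R. \<Sum>s\<in>R. inner (\<tau> (inv r \<otimes> g \<otimes> s) (a s x)) (a r y))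
      = (\<Sum>r\<in>R. \<Sum>s\<in>R. inner (a s x) (\<tau> (inv s \<otimes> inv g \<otimes> r) (a r y)))"
    by (intro sum.cong) (use g in \<open>simp_all add: \<tau>_adjoint a inv_mult_group m_assoc\<close>)
  \<comment> \<open>With the index of the component of \<open>x\<close> outermost, the inner sum
    becomes part of a component of \<open>ind (inv g) y\<close>.\<close>
  also have "\<dots> = (\<Sum>s\<in>R. \<Sum>r\<in>R. inner (a s x) (\<tau> (inv s \<otimes> inv g \<otimes> r) (a r y)))"
    by (rule sum.swap)
  also have "(\<Sum>r\<in>R. inner (a r x) (p (a r y))) + \<dots> = (\<Sum>r\<in>R. inner (a r x) (ind_component (inv g) y r))"
    by (simp add: ind_component_def inner_add_right inner_sum_right sum.distrib)
  also have "\<dots> = inner x (ind (inv g) y)"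
    by (simp add: ind_def inner_sum_right e_adjoint inner_commute[of x] inner_commute[of "a _ x"])
  finally show ?thesis .
qed

lemma ind_isometry:
  assumes g: "g \<in> carrier G" and "x \<in> ind_space" "y \<in> ind_space"
  shows "inner (ind g x) (ind g y) = inner x y"
proof -
  have "inner (ind g x) (ind g y) = inner x (ind (inv g \<otimes> g) y)"
    by (simp only: ind_adjoint[OF g] ind_mult[OF inv_closed[OF g] g])
  then show ?thesis
    using g assms by (simp add: ind_one)
qed

text \<open>The vectors \<open>e r b\<close> with \<open>b \<in> B\<close> may lie outside
  \<open>ind_space\<close>, as \<open>p b\<close> can be nonzero. They only give a finite
  dimensional space around it, from which an orthonormal basis of \<open>ind_space\<close> is
  obtained.\<close>

lemma finite_dim_ind_space: "\<exists>B. finite B \<and> span B = ind_space"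
proof -
  obtain B where B: "finite B" "span B = W"
    using W(2) by blast
  have "e r w \<in> span (\<Union>r\<in>R. e r ` B)" if "r \<in> R" "w \<in> W" for r w
  proof -
    have "e r w \<in> e r ` span B"
      using that B by blast
    also have "\<dots> = span (e r ` B)"
      by (rule linear_span_image[OF e.linear, symmetric])
    also have "\<dots> \<subseteq> span (\<Union>r\<in>R. e r ` B)"
      using that by (intro span_mono) blast
    finally show ?thesis .
  qed
  then have "(\<Sum>r\<in>R. e r (a r v)) \<in> span (\<Union>r\<in>R. e r ` B)" for v
    by (intro span_sum) (simp add: a)
  moreover have "v = (\<Sum>r\<in>R. e r (a r v))" if "v \<in> ind_space" for v
    using that by (simp add: ind_space_def)
  ultimately have sub: "ind_space \<subseteq> span (\<Union>r\<in>R. e r ` B)"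
    by (intro subsetI) (rule ssubst)
  have "finite (\<Union>r\<in>R. e r ` B)"
    using R(1) B(1) by simp
  then obtain C where "finite C" "span C = ind_space"
    using finite_dim_orthonormal_basis[OF subspace_ind_space _ sub] by metis
  then show ?thesis
    by blast
qed

section \<open>The embedding of \<open>W\<close> and the fixed vectors of \<open>N\<close>\<close>

lemma sum_single:
  assumes "r \<in> R"
  shows "(\<Sum>s\<in>R. e s (if s = r then w else 0)) = e r w"
proof -
  have "(\<Sum>s\<in>R. e s (if s = r then w else 0)) = (\<Sum>s\<in>R. if s = r then e s w else 0)"
    by (intro sum.cong) (simp_all add: e.zero)
  then show ?thesis
    using assms R by simp
qed

lemma e_one_ind_space: "w \<in> W \<Longrightarrow> e \<one> w \<in> ind_space"
  using R by (auto simp: ind_space_def a_e sum_single p.zero cong: sum.cong)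

lemma e_one_isometry: "linear_isometry_on W (e \<one>)"
  using R by (simp add: linear_isometry_on_def e.add e.scaleR e_adjoint a_e)

text \<open>In the block at \<open>\<one>\<close> the operator is
  \<open>p w + \<sigma> n (w - p w)\<close>, and \<open>n\<close> fixes \<open>p w\<close>.\<close>

lemma ind_e_one:
  assumes "n \<in> N" "w \<in> W"
  shows "ind n (e \<one> w) = e \<one> (\<sigma> n w)"
proof -
  have "ind_component n (e \<one> w) r = (if r = \<one> then \<sigma> n w else 0)" if "r \<in> R" for r
  proof -
    have "p w + \<tau> n w = \<sigma> n w"
      using assms \<sigma>_add[of n "p w" "w - p w"] by (simp add: \<tau>_def \<sigma>_p)
    then show ?thesis
      using assms that R by (simp add: ind_component_normal a_e p.zero)
  qed
  then show ?thesis
    using R by (simp add: ind_def sum_single)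
qed

text \<open>In block \<open>r\<close> the subgroup acts on the complement part through conjugation
  by \<open>r\<close>. A fixed vector therefore has complement parts that are fixed by all of
  \<open>N\<close> and killed by \<open>p\<close>, hence zero.\<close>

lemma fixed_ind_space:
  "{v \<in> ind_space. \<forall>n\<in>N. ind n v = v} = e \<one> ` fixed_space N W \<sigma>"
proof (intro subset_antisym subsetI)
  fix v assume "v \<in> e \<one> ` fixed_space N W \<sigma>"
  then show "v \<in> {v \<in> ind_space. \<forall>n\<in>N. ind n v = v}"
    by (auto simp: fixed_space_def e_one_ind_space ind_e_one)
next
  fix v assume "v \<in> {v \<in> ind_space. \<forall>n\<in>N. ind n v = v}"
  then have v: "v \<in> ind_space" and fixed: "\<And>n. n \<in> N \<Longrightarrow> ind n v = v"
    by auto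
  have a_v: "a r v = p (a r v)" if r: "r \<in> R" for r
  proof -
    define x where "x = a r v - p (a r v)"
    have x: "x \<in> W"
      by (simp add: x_def a)
    have "\<sigma> n x = x" if n: "n \<in> N" for n
    proof -
      \<comment> \<open>This conjugate of \<open>n\<close> is chosen so that it acts in block
        \<open>r\<close> as \<open>n\<close> itself; normality puts it in \<open>N\<close>.\<close>
      define m where "m = r \<otimes> n \<otimes> inv r"
      have m: "m \<in> N"
        using r n by (simp add: m_def inv_op_closed2)
      have "inv r \<otimes> m \<otimes> r = n"
        using r n by (simp add: m_def m_assoc mult_inv_mult_cancel)
      then have "a r (ind m v) = p (a r v) + \<sigma> n x"
        using r m n by (simp add: a_ind ind_component_normal \<tau>_def x_def)
      then have "\<sigma> n x = a r v - p (a r v)"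
        unfolding fixed[OF m] by (metis add_diff_cancel_left')
      then show ?thesis
        by (simp only: x_def)
    qed
    then have "p x = x"
      using x by (intro p(3)) (simp add: fixed_space_def)
    then show ?thesis
      by (simp add: x_def p.diff)
  qed
  \<comment> \<open>For \<open>r \<noteq> \<one>\<close> membership in \<open>ind_space\<close>
    makes the remaining part \<open>p (a r v)\<close> vanish.\<close>
  then have "a r v = (if r = \<one> then a \<one> v else 0)" if "r \<in> R" for r
    using v that by (auto simp: ind_space_def)
  then have "(\<Sum>r\<in>R. e r (a r v)) = (\<Sum>r\<in>R. e r (if r = \<one> then a \<one> v else 0))"
    by (intro sum.cong) auto
  then have "v = e \<one> (a \<one> v)"
    using v R by (simp add: ind_space_def sum_single)
  moreover have "a \<one> v \<in> fixed_space N W \<sigma>"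
    using a_v[of \<one>] R p(2) by metis
  ultimately show "v \<in> e \<one> ` fixed_space N W \<sigma>"
    by blast
qed

section \<open>Continuity of the induced action\<close>

lemma open_subgroup:
  assumes T: "topspace T = carrier G" and closed: "closedin T N"
    and mult: "continuous_map (prod_topology T T) T (\<lambda>(x, y). x \<otimes> y)"
  shows "openin T N"
proof -
  \<comment> \<open>The union consists of the nontrivial cosets of \<open>N\<close>, finitely many
    preimages of a closed set under left translations. Its complement is \<open>N\<close>.\<close>
  have closed_union: "closedin T (\<Union>r\<in>R - {\<one>}. {x \<in> topspace T. inv r \<otimes> x \<in> N})"
  proof (intro closedin_Union)
    fix S assume "S \<in> (\<lambda>r. {x \<in> topspace T. inv r \<otimes> x \<in> N}) ` (R - {\<one>})"
    then obtain r where r: "r \<in> R" "S = {x \<in> topspace T. inv r \<otimes> x \<in> N}"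
      by blast
    have "continuous_map T T (\<lambda>x. inv r \<otimes> x)"
      using r T by (intro continuous_map_compose[OF _ mult, of _ "\<lambda>x. (inv r, x)", unfolded o_def, simplified])
        (simp add: continuous_map_pairedI)
    then show "closedin T S"
      unfolding r(2) using closed by (rule closedin_continuous_map_preimage)
  qed (use R in simp)
  have union: "topspace T - (\<Union>r\<in>R - {\<one>}. {x \<in> topspace T. inv r \<otimes> x \<in> N}) = N"
  proof (intro subset_antisym subsetI)
    fix x assume x: "x \<in> topspace T - (\<Union>r\<in>R - {\<one>}. {x \<in> topspace T. inv r \<otimes> x \<in> N})"
    then obtain r where "r \<in> R" "inv r \<otimes> x \<in> N"
      using R_unique[of x] T by auto
    then show "x \<in> N"
      using x T by (cases "r = \<one>") auto
  next
    fix x assume x: "x \<in> N"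
    \<comment> \<open>Both \<open>r\<close> and \<open>\<one>\<close> represent the coset of
      \<open>x\<close>.\<close>
    have "r = \<one>" if "r \<in> R" "inv r \<otimes> x \<in> N" for r
      using R_unique[of x] R that x by (metis N_carrier inv_one l_one)
    then show "x \<in> topspace T - (\<Union>r\<in>R - {\<one>}. {x \<in> topspace T. inv r \<otimes> x \<in> N})"
      using x T by auto
  qed
  show ?thesis
    using openin_diff[OF openin_topspace closed_union] unfolding union .
qed

text \<open>The product splits into disjoint open pieces over \<open>N\<close> and over its
  complement. On the first, \<open>\<tau>\<close> is \<open>\<sigma>\<close> after a continuous
  projection; on the second it is zero.\<close>

lemma continuous_\<tau>:
  assumes T: "topspace T = carrier G" and clopen: "closedin T N" "openin T N"
    and \<sigma>: "continuous_map (prod_topology (subtopology T N) (top_of_set W)) (top_of_set W) (\<lambda>(n, w). \<sigma> n w)"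
  shows "continuous_map (prod_topology T (top_of_set W)) euclidean (\<lambda>(h, w). \<tau> h w)"
\<comment> \<open>The pieces are indexed by truth values, \<open>True\<close> standing for the piece
  over \<open>N\<close>.\<close>
proof (rule pasting_lemma[where I = UNIV and T = "\<lambda>b. if b then N \<times> W else (topspace T - N) \<times> W"
      and f = "\<lambda>b x. if b then \<sigma> (fst x) (snd x - p (snd x)) else 0"])
  have sub: "subtopology (prod_topology T (top_of_set W)) (N \<times> W)
      = prod_topology (subtopology T N) (top_of_set W)"
    by (simp add: subtopology_Times subtopology_subtopology)
  have "continuous_map (top_of_set W) (top_of_set W) (\<lambda>w. w - p w)"
    using p.continuous_on[OF continuous_on_id] by (auto intro!: continuous_intros)
  then have q: "continuous_map (prod_topology (subtopology T N) (top_of_set W))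
      (prod_topology (subtopology T N) (top_of_set W)) (\<lambda>x. (fst x, snd x - p (snd x)))"
    by (intro continuous_map_pairedI continuous_map_fst
        continuous_map_compose[OF continuous_map_snd, unfolded o_def])
  have "continuous_map (prod_topology (subtopology T N) (top_of_set W)) euclidean
      (\<lambda>x. \<sigma> (fst x) (snd x - p (snd x)))"
    using continuous_map_compose[OF q \<sigma>] by (auto simp: o_def continuous_map_in_subtopology)
  then show "continuous_map (subtopology (prod_topology T (top_of_set W))
      (if b then N \<times> W else (topspace T - N) \<times> W)) euclidean
      (\<lambda>x. if b then \<sigma> (fst x) (snd x - p (snd x)) else 0)" for b
    by (cases b) (simp_all add: sub)
  show "openin (prod_topology T (top_of_set W)) (if b then N \<times> W else (topspace T - N) \<times> W)" for b
    using clopen by (auto simp: openin_prod_Times_iff intro: openin_diff)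
  fix x assume x: "x \<in> topspace (prod_topology T (top_of_set W))"
  show "\<exists>b. b \<in> UNIV \<and> x \<in> (if b then N \<times> W else (topspace T - N) \<times> W) \<and>
      (case x of (h, w) \<Rightarrow> \<tau> h w) = (if b then \<sigma> (fst x) (snd x - p (snd x)) else 0)"
    using x by (intro exI[of _ "fst x \<in> N"]) (auto simp: \<tau>_def)
next
  fix b c x assume "x \<in> topspace (prod_topology T (top_of_set W))
      \<inter> (if b then N \<times> W else (topspace T - N) \<times> W) \<inter> (if c then N \<times> W else (topspace T - N) \<times> W)"
  then have "b = c"
    by (cases b; cases c) auto
  then show "(if b then \<sigma> (fst x) (snd x - p (snd x)) else 0)
      = (if c then \<sigma> (fst x) (snd x - p (snd x)) else 0)"
    by simp
qed

lemma continuous_ind: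
  assumes T: "topspace T = carrier G"
    and mult: "continuous_map (prod_topology T T) T (\<lambda>(x, y). x \<otimes> y)"
    and \<tau>: "continuous_map (prod_topology T (top_of_set W)) euclidean (\<lambda>(h, w). \<tau> h w)"
  shows "continuous_map (prod_topology T (top_of_set S)) euclidean (\<lambda>(g, v). ind g v)"
proof -
  let ?X = "prod_topology T (top_of_set S)"
  have "continuous_map (top_of_set S) (top_of_set W) (a r)" for r
    using a.continuous_on[OF continuous_on_id] a by auto
  then have a_snd: "continuous_map ?X (top_of_set W) (\<lambda>x. a r (snd x))" for r
    by (intro continuous_map_compose[OF continuous_map_snd, unfolded o_def])
  have mult': "continuous_map X T (\<lambda>x. f x \<otimes> h x)"
    if "continuous_map X T f" "continuous_map X T h" for X f h
    using continuous_map_compose[OF continuous_map_pairedI[OF that] mult] by (simp add: o_def)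
  have \<tau>': "continuous_map ?X euclidean (\<lambda>x. \<tau> (inv r \<otimes> fst x \<otimes> s) (a s (snd x)))"
    if "r \<in> R" "s \<in> R" for r s
  proof -
    have "continuous_map ?X T (\<lambda>x. inv r \<otimes> fst x \<otimes> s)"
      using that T by (intro mult' continuous_map_fst) auto
    then show ?thesis
      using continuous_map_compose[OF continuous_map_pairedI[OF _ a_snd] \<tau>] by (simp add: o_def)
  qed
  have p_a: "continuous_map ?X euclidean (\<lambda>x. p (a r (snd x)))" for r
    by (rule continuous_map_compose[OF a_snd, of _ p, unfolded o_def])
      (use p.continuous_on[OF continuous_on_id] in auto)
  have ind_component: "continuous_map ?X euclidean (\<lambda>x. ind_component (fst x) (snd x) r)"
    if "r \<in> R" for r
    unfolding ind_component_def using that R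
    by (intro continuous_map_add continuous_map_sum p_a \<tau>')
  have e_euclidean: "continuous_map euclidean euclidean (e r)" for r
    using e.continuous_on[OF continuous_on_id] by auto
  have "continuous_map ?X euclidean (\<lambda>x. e r (ind_component (fst x) (snd x) r))" if "r \<in> R" for r
    using continuous_map_compose[OF ind_component[OF that] e_euclidean[of r]] by (simp only: o_def)
  then show ?thesis
    unfolding ind_def case_prod_unfold using R by (intro continuous_map_sum)
qed

text \<open>The operators \<open>ind g\<close> are defined on the whole host. Restricting them makes
  them extensional, as \<open>group_action\<close> demands, without changing their values on
  \<open>ind_space\<close>.\<close>

lemma orthogonal_representation_ind:
  assumes T: "topspace T = carrier G" "closedin T N"
    and mult: "continuous_map (prod_topology T T) T (\<lambda>(x, y). x \<otimes> y)"
    and \<sigma>: "continuous_map (prod_topology (subtopology T N) (top_of_set W)) (top_of_set W) (\<lambda>(n, w). \<sigma> n w)"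
  shows "orthogonal_representation G T ind_space (\<lambda>g. restrict (ind g) ind_space)"
  unfolding orthogonal_representation_def
proof (intro conjI ballI)
  show "group_action G ind_space (\<lambda>g. restrict (ind g) ind_space)"
    by (rule group_actionI) (simp_all add: is_group ind_closed ind_one ind_mult)
  show "linear_isometry_on ind_space (restrict (ind g) ind_space)" if "g \<in> carrier G" for g
    using subspace_ind_space that
    by (simp add: linear_isometry_on_def subspace_add subspace_scale ind_add ind_scaleR ind_isometry)
  have "continuous_map (prod_topology T (top_of_set ind_space)) euclidean (\<lambda>(g, v). ind g v)"
    using continuous_ind[OF T(1) mult] continuous_\<tau>[OF T open_subgroup[OF T mult] \<sigma>] .
  then have "continuous_map (prod_topology T (top_of_set ind_space)) (top_of_set ind_space) (\<lambda>(g, v). ind g v)"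
    by (auto simp: continuous_map_in_subtopology ind_closed)
  then show "continuous_map (prod_topology T (top_of_set ind_space)) (top_of_set ind_space)
      (\<lambda>(g, v). restrict (ind g) ind_space v)"
    by (rule continuous_map_eq) auto
  show "subspace ind_space" "\<exists>B. finite B \<and> span B = ind_space"
    by (rule subspace_ind_space finite_dim_ind_space)+
qed

end

section \<open>Extending an arbitrary representation of \<open>N\<close>\<close>

theorem lemma4p2p3:
  fixes G :: "('g, 'm) monoid_scheme" and T :: "'g topology"
    and d :: nat and A :: "'g chart set" and N :: "'g set"
  assumes "compact_lie_group G T d A"
    and "N \<lhd> G" and "closedin T N" and "finite (rcosets\<^bsub>G\<^esub> N)"
  shows "orthogonally_final TYPE('w::real_inner) G T N"
  unfolding orthogonally_final_def
proof (intro allI impI)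
  fix W :: "'w set" and \<sigma>
  assume \<sigma>: "orthogonal_representation (G\<lparr>carrier := N\<rparr>) (subtopology T N) W \<sigma>"
  interpret normal N G by fact
  interpret \<sigma>: group_action "G\<lparr>carrier := N\<rparr>" W \<sigma>
    using \<sigma> by (simp add: orthogonal_representation_def)
  have T: "topspace T = carrier G"
    and mult: "continuous_map (prod_topology T T) T (\<lambda>(x, y). x \<otimes>\<^bsub>G\<^esub> y)"
    using assms(1) by (simp_all add: compact_lie_group_def lie_group_def smooth_map_def)
  obtain B where W: "subspace W" "finite B" "span B = W"
    using \<sigma> by (auto simp: orthogonal_representation_def)
  have isometry: "linear_isometry_on W (\<sigma> n)" if "n \<in> N" for n
    using \<sigma> that by (simp add: orthogonal_representation_def)
  obtain R where R: "finite R" "R \<subseteq> carrier G" "\<one>\<^bsub>G\<^esub> \<in> R"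
    "\<And>g. g \<in> carrier G \<Longrightarrow> \<exists>!r. r \<in> R \<and> inv\<^bsub>G\<^esub> r \<otimes>\<^bsub>G\<^esub> g \<in> N"
    using finite_transversal[OF assms(4)] by blast
  have zero: "\<sigma> n 0 = 0" if "n \<in> N" for n
    using isometry[OF that] subspace_0[OF W(1)] by (metis linear_isometry_on_def scale_zero_left)
  have "subspace (fixed_space N W \<sigma>)"
    using W(1) isometry zero
    by (auto simp: subspace_def fixed_space_def linear_isometry_on_def)
  moreover have "fixed_space N W \<sigma> \<subseteq> span B"
    using W(3) by (auto simp: fixed_space_def)
  ultimately obtain p where p: "bounded_linear p" "\<And>x. p x \<in> fixed_space N W \<sigma>"
    "\<And>x. x \<in> fixed_space N W \<sigma> \<Longrightarrow> p x = x" "\<And>x y. inner (p x) y = inner x (p y)"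
    using orthogonal_projection_exists[OF _ W(2)] by blast
  \<comment> \<open>The copies of \<open>W\<close> are indexed by the coset representatives and
    placed in \<open>fin_seq\<close>, the host prescribed for \<open>V\<close>.\<close>
  obtain e :: "'g \<Rightarrow> 'w \<Rightarrow> fin_seq" and a
    where ea: "\<And>r. bounded_linear (e r)" "\<And>r. bounded_linear (a r)" "\<And>r v. a r v \<in> W"
    "\<And>r s w. r \<in> R \<Longrightarrow> s \<in> R \<Longrightarrow> w \<in> W \<Longrightarrow> a r (e s w) = (if r = s then w else 0)"
    "\<And>r w v. inner (e r w) v = inner w (a r v)"
    using orthogonal_copies[OF W R(1)] by blast
  interpret induced_representation N G R W \<sigma> p e a
  proof (intro induced_representation.intro induced_representation_axioms.intro)
    show "normal N G"
      by (rule assms(2))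
    show "\<exists>B. finite B \<and> span B = W"
      using W by blast
    show "\<sigma> n w \<in> W" if "n \<in> N" "w \<in> W" for n w
      using \<sigma>.element_image that by simp
    show "\<sigma> \<one>\<^bsub>G\<^esub> w = w" if "w \<in> W" for w
      using fun_cong[OF \<sigma>.id_eq_one, of w] that by simp
    show "\<sigma> (m \<otimes>\<^bsub>G\<^esub> n) w = \<sigma> m (\<sigma> n w)" if "m \<in> N" "n \<in> N" "w \<in> W" for m n w
      using \<sigma>.composition_rule[OF that(3)] that by simp
  qed (fact R W isometry p ea)+
  have "orthogonal_representation G T ind_space (\<lambda>g. restrict (ind g) ind_space)"
    using \<sigma> by (intro orthogonal_representation_ind T assms(3) mult)
      (simp add: orthogonal_representation_def)
  moreover have "e \<one>\<^bsub>G\<^esub> \<in> W \<rightarrow> ind_space"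
    using e_one_ind_space by blast
  moreover have "\<forall>n\<in>N. \<forall>w\<in>W. e \<one>\<^bsub>G\<^esub> (\<sigma> n w) = restrict (ind n) ind_space (e \<one>\<^bsub>G\<^esub> w)"
    by (simp add: e_one_ind_space ind_e_one)
  moreover have "bij_betw (e \<one>\<^bsub>G\<^esub>) (fixed_space N W \<sigma>)
      (fixed_space N ind_space (\<lambda>g. restrict (ind g) ind_space))"
  proof -
    \<comment> \<open>On \<open>W\<close> the map \<open>a\<close> at the identity is a left inverse
      of the embedding.\<close>
    have "inj_on (e \<one>\<^bsub>G\<^esub>) W"
      using a_e R(3) by (metis inj_onI)
    then have "inj_on (e \<one>\<^bsub>G\<^esub>) (fixed_space N W \<sigma>)"
      by (rule inj_on_subset) (auto simp: fixed_space_def)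
    moreover have "fixed_space N ind_space (\<lambda>g. restrict (ind g) ind_space)
        = {v \<in> ind_space. \<forall>n\<in>N. ind n v = v}"
      by (auto simp: fixed_space_def)
    ultimately show ?thesis
      by (simp add: bij_betw_def fixed_ind_space)
  qed
  ultimately show "\<exists>(V :: fin_seq set) \<rho> f. orthogonal_representation G T V \<rho> \<and>
      f \<in> W \<rightarrow> V \<and> linear_isometry_on W f \<and> (\<forall>n\<in>N. \<forall>w\<in>W. f (\<sigma> n w) = \<rho> n (f w)) \<and>
      bij_betw f (fixed_space N W \<sigma>) (fixed_space N V \<rho>)"
    using e_one_isometry by blast
qed

end
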